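(* Let $T$ be a process tree. The probability of a run prefix $\sigma=\langle\alpha_1,\dots,\alpha_p\rangle$ in the semantic tree of $T$ (i.e. the probability that a uniformly random concurrent run of $T$ has $\sigma$ as prefix) is equal to $$\prod_{k=1}^{p}\frac{|T(\alpha_k)|}{|T|-k+1}.$$
   Context: A process tree $T$ is a plane rooted tree whose nodes carry pairwise distinct names (actions); $|T|$ is its number of nodes; for a node $v$, $T(v)$ is the subtree of all descendants of $v$ (including $v$). For $T$ whose root has children $v_1,\dots,v_r$ from left to right, and $1\le i\le r$, the $i$-contraction $T\lhd i$ is the plane tree with root $v_i$ whose root-subtrees are, from left to right, $T(v_1),\dots,T(v_{i-1}),T(v_{i_1}),\dots,T(v_{i_m}),T(v_{i+1}),\dots,T(v_r)$, where $v_{i_1},\dots,v_{i_m}$ are the children of $v_i$ in order. The semantic tree $\mathrm{Sem}(T)$ is: $T$ itself if $T$ is a single node; otherwise the tree with the root $t$ of $T$ as root and root-subtrees $\mathrm{Sem}(T\lhd1),\dots,\mathrm{Sem}(T\lhd r)$ from left to right. A concurrent run of $T$ is a branch (root-to-leaf path) of $\mathrm{Sem}(T)$; a run prefix of length $p$ is the sequence of the first $p$ nodes of a run. *)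

theory Defs
  imports "HOL-Probability.Probability" "HOL-Library.Sublist"
begin

datatype 'a ptree = Node (label: 'a) (children: "'a ptree list")

primrec preorder :: "'a ptree \<Rightarrow> 'a list" where
  "preorder (Node a ts) = a # concat (map preorder ts)"

primrec node_count :: "'a ptree \<Rightarrow> nat" where
  "node_count (Node a ts) = 1 + sum_list (map node_count ts)"

definition process_tree :: "'a ptree \<Rightarrow> bool" where
  "process_tree T \<longleftrightarrow> distinct (preorder T)"

fun subtrees :: "'a ptree \<Rightarrow> 'a ptree set" where
  "subtrees (Node a ts) = insert (Node a ts) (\<Union>t\<in>set ts. subtrees t)"

text \<open>
  Nodes are identified with their names, so this is meaningful only if \<open>T\<close> is a process tree
  and \<open>v\<close> is one of its names.
\<close>
definition subtree_at :: "'a ptree \<Rightarrow> 'a \<Rightarrow> 'a ptree" where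
  "subtree_at T v = (THE S. S \<in> subtrees T \<and> label S = v)"

text \<open>The index is 1-based; only \<open>1 \<le> i \<le> length (children T)\<close> is meaningful.\<close>
definition contraction :: "'a ptree \<Rightarrow> nat \<Rightarrow> 'a ptree" (infixl "\<lhd>" 70) where
  "T \<lhd> i =
     (let ts = children T; S = ts ! (i - 1)
      in Node (label S) (take (i - 1) ts @ children S @ drop i ts))"

lemma node_count_contraction:
  assumes "1 \<le> i" "i \<le> length (children T)"
  shows "Suc (node_count (T \<lhd> i)) = node_count T"
proof -
  define ts where "ts = children T"
  define j where "j = i - 1"
  have j: "j < length ts" "i = Suc j"
    using assms by (auto simp: ts_def j_def)
  obtain a us where S: "ts ! j = Node a us"
    by (cases "ts ! j") auto
  have "ts = take j ts @ Node a us # drop (Suc j) ts"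
    using id_take_nth_drop[OF j(1)] S by simp
  then have "sum_list (map node_count ts)
      = sum_list (map node_count (take j ts @ Node a us # drop (Suc j) ts))"
    by simp
  moreover have "node_count T = 1 + sum_list (map node_count ts)"
    by (cases T) (simp add: ts_def)
  moreover have "T \<lhd> i = Node a (take j ts @ us @ drop (Suc j) ts)"
    using j S by (simp add: contraction_def Let_def ts_def)
  ultimately show ?thesis by simp
qed

text \<open>For a single node the list of root-subtrees is empty, so the tree is its own semantic tree.\<close>
function sem :: "'a ptree \<Rightarrow> 'a ptree" where
  "sem T = Node (label T) (map (\<lambda>i. sem (T \<lhd> i)) [1..<Suc (length (children T))])"
  by auto
termination
proof (relation "Wellfounded.measure node_count")
  fix T :: "'a ptree" and i
  assume "i \<in> set [1..<Suc (length (children T))]"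
  then have "Suc (node_count (T \<lhd> i)) = node_count T"
    by (intro node_count_contraction) auto
  then show "(T \<lhd> i, T) \<in> Wellfounded.measure node_count" by simp
qed simp

declare sem.simps [simp del]

fun branches :: "'a ptree \<Rightarrow> 'a list set" where
  "branches (Node a []) = {[a]}"
| "branches (Node a ts) = (\<Union>t\<in>set ts. Cons a ` branches t)"

text \<open>
  In a process tree siblings of the semantic tree carry different names, so a branch of the
  semantic tree is determined by its sequence of names and the set \<open>runs T\<close> has exactly one
  element for each branch.
\<close>
definition runs :: "'a ptree \<Rightarrow> 'a list set" where
  "runs T = branches (sem T)"

definition run_prefix :: "'a ptree \<Rightarrow> nat \<Rightarrow> 'a list \<Rightarrow> bool" where
  "run_prefix T p \<sigma> \<longleftrightarrow> (\<exists>\<rho>\<in>runs T. p \<le> length \<rho> \<and> \<sigma> = take p \<rho>)"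

text \<open>\<^const>\<open>pmf_of_set\<close> is unspecified on empty and infinite sets; runs are neither.\<close>
lemma finite_branches: "finite (branches T)"
  by (induction T rule: branches.induct) auto

lemma branches_nonempty: "branches T \<noteq> {}"
  by (induction T rule: branches.induct) auto

lemma finite_runs: "finite (runs T)"
  by (simp add: runs_def finite_branches)

lemma runs_nonempty: "runs T \<noteq> {}"
  by (simp add: runs_def branches_nonempty)

definition random_run :: "'a ptree \<Rightarrow> 'a list pmf" where
  "random_run T = pmf_of_set (runs T)"

end

theory Submission
  imports Defs
begin

text \<open>
  Let \<open>h T\<close> be the product of \<open>|T(v)|\<close> over all nodes \<open>v\<close> of \<open>T\<close>. Contracting the child \<open>v\<close> of the
  root removes the factor \<open>|T(v)|\<close> from \<open>h\<close> and replaces the root factor \<open>|T|\<close> by \<open>|T| - 1\<close>, so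
  the hook length formula \<open>card (runs T) = |T|! / h T\<close> follows by induction on \<open>T\<close>. Hence a
  uniformly random run moves from the root to its child \<open>v\<close> with probability \<open>|T(v)| / (|T| - 1)\<close>.
  Contraction does not change the subtrees at names other than the root and \<open>v\<close>, so these
  transition probabilities multiply up to the product over the prefix.
\<close>

section \<open>Effect of a contraction on nodes and names\<close>

lemma children_splitE:
  assumes "i < length (children T)"
  obtains a xs b us ys where "T = Node a (xs @ Node b us # ys)" "length xs = i"
    "children T ! i = Node b us" "T \<lhd> Suc i = Node b (xs @ us @ ys)"
proof -
  obtain a ts where T: "T = Node a ts" by (cases T)
  obtain b us where S: "ts ! i = Node b us" by (cases "ts ! i")
  have i: "i < length ts" using assms T by simp
  have "ts = take i ts @ Node b us # drop (Suc i) ts"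
    using id_take_nth_drop[OF i] S by simp
  moreover have "T \<lhd> Suc i = Node b (take i ts @ us @ drop (Suc i) ts)"
    using S T by (simp add: contraction_def)
  ultimately show ?thesis using that[of a "take i ts" b us "drop (Suc i) ts"] T S i by simp
qed

lemma node_count_pos: "node_count T > 0"
  by (cases T) simp

lemma node_count_contraction_Suc:
  assumes "i < length (children T)"
  shows "node_count T = Suc (node_count (T \<lhd> Suc i))"
  using assms node_count_contraction[of "Suc i" T] by simp

lemma label_contraction: "label (T \<lhd> Suc i) = label (children T ! i)"
  by (simp add: contraction_def Let_def)

text \<open>Contraction moves the child's name to the front, so the preorder may be permuted as well
  as shortened; multisets ignore the order and still determine distinctness.\<close>

lemma mset_preorder_contraction:
  assumes "i < length (children T)"
  shows "mset (preorder T) = add_mset (label T) (mset (preorder (T \<lhd> Suc i)))"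
  using assms by (rule children_splitE) simp

lemma process_tree_contraction:
  assumes "process_tree T" "i < length (children T)"
  shows "process_tree (T \<lhd> Suc i)"
proof -
  have "mset (preorder T) = mset (label T # preorder (T \<lhd> Suc i))"
    using mset_preorder_contraction[OF assms(2)] by simp
  then have "distinct (label T # preorder (T \<lhd> Suc i))"
    using assms(1) unfolding process_tree_def by (metis mset_eq_imp_distinct_iff)
  then show ?thesis by (simp add: process_tree_def)
qed

section \<open>Runs, split by the first contraction\<close>

lemma runs_leaf: "children T = [] \<Longrightarrow> runs T = {[label T]}"
  by (simp add: runs_def sem.simps[of T])

lemma runs_step:
  assumes "children T \<noteq> []"
  shows "runs T = (\<Union>i<length (children T). Cons (label T) ` runs (T \<lhd> Suc i))"
proof -
  have branches: "branches (Node a ts) = (\<Union>t\<in>set ts. Cons a ` branches t)" if "ts \<noteq> []"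
    for a :: 'a and ts
    using that by (cases ts) auto
  have "runs T = (\<Union>i\<in>{1..<Suc (length (children T))}. Cons (label T) ` runs (T \<lhd> i))"
    using assms by (simp add: runs_def sem.simps[of T] branches del: upt_Suc)
  also have "{1..<Suc (length (children T))} = Suc ` {..<length (children T)}"
    by (simp add: lessThan_atLeast0)
  finally show ?thesis by simp
qed

lemma runs_cases:
  assumes "\<rho> \<in> runs T"
  obtains (leaf) "children T = []" "\<rho> = [label T]"
    | (step) i \<rho>' where "i < length (children T)" "\<rho>' \<in> runs (T \<lhd> Suc i)" "\<rho> = label T # \<rho>'"
  using assms by (cases "children T = []") (auto simp: runs_leaf runs_step)

lemma runs_ConsD: "x # \<rho> \<in> runs T \<Longrightarrow> x = label T"
  by (erule runs_cases) auto

lemma runs_nonNil: "\<rho> \<in> runs T \<Longrightarrow> \<rho> \<noteq> []"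
  by (erule runs_cases) auto

text \<open>Each step of a run drops exactly the current root, so every node is visited once. This
  later yields distinct names along a prefix.\<close>

lemma mset_run: "\<rho> \<in> runs T \<Longrightarrow> mset \<rho> = mset (preorder T)"
proof (induction \<rho> arbitrary: T)
  case Nil
  then show ?case using runs_nonNil by blast
next
  case (Cons x \<rho>)
  from Cons.prems show ?case
  proof (cases rule: runs_cases)
    case leaf
    then show ?thesis by (cases T) simp
  next
    case (step i \<rho>')
    then show ?thesis using Cons.IH mset_preorder_contraction by fastforce
  qed
qed

section \<open>Subtrees addressed by name\<close>

lemma distinct_map_preorder:
  assumes "distinct (concat (map preorder ts))"
  shows "distinct (map preorder ts)"
proof -
  \<comment> \<open>Distinctness of a concatenation still allows repeated empty lists, which are
    excluded here.\<close>
  have "preorder t \<noteq> []" for t :: "'a ptree"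
    by (cases t) simp
  then have "[] \<notin> set (map preorder ts)" by (metis image_iff list.set_map)
  then show ?thesis using assms by (simp add: distinct_concat_iff)
qed

lemma label_image_subtrees: "label ` subtrees T = set (preorder T)"
proof (induction T)
  case (Node a ts)
  then show ?case by (simp add: image_UN)
qed

text \<open>Makes the \<open>THE\<close> in \<open>subtree_at\<close> well defined.\<close>

lemma inj_on_label_subtrees: "process_tree T \<Longrightarrow> inj_on label (subtrees T)"
  unfolding process_tree_def
proof (induction T)
  case (Node a ts)
  have label: "label S \<in> set (preorder t)" if "S \<in> subtrees t" for S t :: "'a ptree"
    using imageI[OF that, of label] by (simp add: label_image_subtrees)
  have dist: "distinct (concat (map preorder ts))" and
    a: "\<And>t. t \<in> set ts \<Longrightarrow> a \<notin> set (preorder t)"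
    using Node.prems by auto
  \<comment> \<open>A common label lies in the preorders of both children, so distinctness forces
    the two children to coincide.\<close>
  have child: "S = S'" if S: "S \<in> subtrees t" "t \<in> set ts" and S': "S' \<in> subtrees t'" "t' \<in> set ts"
    and eq: "label S = label S'" for S S' t t'
  proof -
    have "set (preorder t) \<inter> set (preorder t') \<noteq> {}"
      using label[OF S(1)] label[OF S'(1)] eq by auto
    then have "preorder t = preorder t'"
      using dist S(2) S'(2) unfolding distinct_concat_iff by (metis image_eqI set_map)
    then have "t = t'"
      using distinct_map_preorder[OF dist] S(2) S'(2) by (auto simp: distinct_map dest: inj_onD)
    moreover have "distinct (preorder t)"
      using dist S(2) by (auto simp: distinct_concat_iff)
    ultimately show ?thesis
      using Node.IH[OF S(2)] S(1) S'(1) eq unfolding inj_on_def by metis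
  qed
  show ?case
  proof (rule inj_onI)
    fix S S' assume "S \<in> subtrees (Node a ts)" "S' \<in> subtrees (Node a ts)" "label S = label S'"
    then show "S = S'" using child label a by (auto; metis)
  qed
qed

lemma subtree_at_label:
  assumes "process_tree T" "S \<in> subtrees T"
  shows "subtree_at T (label S) = S"
  unfolding subtree_at_def
  using assms inj_on_label_subtrees by (blast dest: inj_onD)

lemma self_in_subtrees: "T \<in> subtrees T"
  by (cases T) simp

lemma subtrees_contraction:
  assumes "i < length (children T)"
  shows "subtrees (T \<lhd> Suc i) \<subseteq> insert (T \<lhd> Suc i) (subtrees T)"
  using assms by (rule children_splitE) auto

text \<open>Only the root of a contraction can carry a new subtree; all others are inherited from
  \<open>T\<close>, where a name determines its subtree.\<close>

lemma subtree_at_contraction: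
  assumes "process_tree T" "i < length (children T)"
    and "v \<in> set (preorder (T \<lhd> Suc i))" "v \<noteq> label (T \<lhd> Suc i)"
  shows "subtree_at (T \<lhd> Suc i) v = subtree_at T v"
proof -
  obtain S where S: "S \<in> subtrees (T \<lhd> Suc i)" "label S = v"
    using assms(3) label_image_subtrees by (metis imageE)
  moreover from this have "S \<in> subtrees T"
    using subtrees_contraction[OF assms(2)] assms(4) by auto
  ultimately show ?thesis
    using subtree_at_label process_tree_contraction assms(1,2) by metis
qed

section \<open>Hook products and the number of runs\<close>

primrec hook_product :: "'a ptree \<Rightarrow> nat" where
  "hook_product (Node a ts) = node_count (Node a ts) * prod_list (map hook_product ts)"

lemma hook_product_pos: "hook_product T > 0"
proof (induction T)
  case (Node a ts)
  then have "0 \<notin> set (map hook_product ts)" by force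
  then have "prod_list (map hook_product ts) \<noteq> 0" by (simp add: prod_list_zero_iff)
  then show ?case by simp
qed

text \<open>Both sides consist of the sizes of the two roots, the size of the contracted child and
  the hook products of the remaining subtrees. Cross-multiplying avoids division of natural
  numbers.\<close>

lemma hook_product_contraction:
  assumes "i < length (children T)"
  shows "hook_product (T \<lhd> Suc i) * node_count T * node_count (children T ! i) =
    node_count (T \<lhd> Suc i) * hook_product T"
  using assms by (rule children_splitE) (simp add: algebra_simps)

lemma inj_on_label_children:
  assumes "process_tree T"
  shows "inj_on (\<lambda>i. label (children T ! i)) {..<length (children T)}"
proof (rule inj_onI)
  fix i j
  obtain a ts where T: "T = Node a ts" by (cases T)
  assume ij: "i \<in> {..<length (children T)}" "j \<in> {..<length (children T)}"
    and eq: "label (children T ! i) = label (children T ! j)"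
  have sub: "children T ! k \<in> subtrees T" if "k < length (children T)" for k
    using that T by (auto intro!: bexI[of _ "ts ! k"] self_in_subtrees)
  have same: "ts ! i = ts ! j"
    using inj_onD[OF inj_on_label_subtrees[OF assms] eq] sub ij T by simp
  have "distinct (map preorder ts)"
    using assms T by (intro distinct_map_preorder) (simp add: process_tree_def)
  then have "distinct ts" by (simp add: distinct_map)
  then show "i = j" using same ij T by (simp add: nth_eq_iff_index_eq)
qed

text \<open>The first name of a run reveals which child was contracted, since siblings have
  different names.\<close>

lemma disjoint_runs_contraction:
  assumes "process_tree T" "i < length (children T)" "j < length (children T)" "i \<noteq> j"
  shows "runs (T \<lhd> Suc i) \<inter> runs (T \<lhd> Suc j) = {}"
proof -
  have "label (T \<lhd> Suc i) \<noteq> label (T \<lhd> Suc j)"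
    using inj_on_label_children[OF assms(1)] assms by (auto simp: label_contraction dest: inj_onD)
  then show ?thesis
    using runs_ConsD runs_nonNil by (metis disjoint_iff list.exhaust)
qed

lemma card_runs_step:
  assumes "process_tree T" "children T \<noteq> []"
  shows "card (runs T) = (\<Sum>i<length (children T). card (runs (T \<lhd> Suc i)))"
proof -
  have "card (runs T) =
      (\<Sum>i<length (children T). card (Cons (label T) ` runs (T \<lhd> Suc i)))"
    unfolding runs_step[OF assms(2)] using disjoint_runs_contraction[OF assms(1)]
    by (intro card_UN_disjoint) (auto simp: finite_runs)
  then show ?thesis by (simp add: card_image)
qed

text \<open>The hook length formula without division. The induction is on the size because a
  contraction is smaller but not a subterm.\<close>

lemma card_runs_hook:
  "process_tree T \<Longrightarrow> card (runs T) * hook_product T = fact (node_count T)"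
proof (induction "node_count T" arbitrary: T rule: less_induct)
  case less
  show ?case
  proof (cases "children T = []")
    case True
    then show ?thesis by (cases T) (simp add: runs_leaf)
  next
    case False
    let ?r = "length (children T)"
    let ?m = "node_count T - 1"
    \<comment> \<open>The children share all nodes but the root; this identity closes the recursion
      for the number of runs.\<close>
    have sum: "(\<Sum>i<?r. node_count (children T ! i)) = ?m"
      by (cases T) (simp add: sum_list_sum_nth lessThan_atLeast0)
    have pos: "?m > 0"
      using node_count_contraction_Suc[of 0 T] node_count_pos[of "T \<lhd> Suc 0"] False by simp
    \<comment> \<open>Scaling by \<open>?m * hook_product T\<close> turns each summand into a common
      constant times the size of the contracted child.\<close>
    have step: "?m * hook_product T * card (runs (T \<lhd> Suc i)) =
        node_count T * fact ?m * node_count (children T ! i)" if "i < ?r" for i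
    proof -
      have n: "node_count (T \<lhd> Suc i) = ?m" using node_count_contraction_Suc[OF that] by simp
      have "card (runs (T \<lhd> Suc i)) * hook_product (T \<lhd> Suc i) = fact ?m"
        using less.hyps[of "T \<lhd> Suc i"] process_tree_contraction[OF less.prems that] n pos
        by simp
      moreover have "hook_product (T \<lhd> Suc i) * node_count T * node_count (children T ! i) =
          ?m * hook_product T"
        using hook_product_contraction[OF that] n by simp
      ultimately show ?thesis by (metis mult.assoc mult.commute)
    qed
    have "?m * (card (runs T) * hook_product T) =
        (\<Sum>i<?r. ?m * hook_product T * card (runs (T \<lhd> Suc i)))"
      by (simp add: card_runs_step[OF less.prems False] sum_distrib_left mult_ac)
    also have "\<dots> = node_count T * fact ?m * (\<Sum>i<?r. node_count (children T ! i))"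
      unfolding sum_distrib_left by (intro sum.cong) (simp_all only: step lessThan_iff)
    also have "\<dots> = ?m * fact (node_count T)"
      unfolding sum by (simp add: fact_reduce[OF node_count_pos[of T]])
    finally show ?thesis using pos by simp
  qed
qed

section \<open>Frequency of a prefix among the runs\<close>

lemma card_runs_pos: "card (runs T) > 0"
  by (simp add: card_gt_0_iff finite_runs runs_nonempty)

text \<open>Quotient of the hook length formulas for the contraction and for \<open>T\<close>; the
  denominator on the right is |T| - 1.\<close>

lemma transition_probability:
  assumes "process_tree T" "i < length (children T)"
  shows "real (card (runs (T \<lhd> Suc i))) / card (runs T) =
    node_count (children T ! i) / node_count (T \<lhd> Suc i)"
proof -
  let ?S = "T \<lhd> Suc i" and ?c = "node_count (children T ! i)"
  have n: "node_count T = Suc (node_count ?S)"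
    by (rule node_count_contraction_Suc[OF assms(2)])
  have S: "card (runs ?S) * hook_product ?S = fact (node_count ?S)"
    using card_runs_hook process_tree_contraction assms by blast
  have "(card (runs ?S) * node_count ?S) * hook_product T =
      card (runs ?S) * (hook_product ?S * node_count T * ?c)"
    using hook_product_contraction[OF assms(2)] by simp
  also have "\<dots> = (card (runs T) * ?c) * hook_product T"
    using S card_runs_hook[OF assms(1)] n by (metis fact_Suc mult.assoc mult.commute of_nat_id)
  finally have "card (runs ?S) * node_count ?S = card (runs T) * ?c"
    using hook_product_pos[of T] by simp
  then have "real (card (runs ?S)) * node_count ?S = real (card (runs T)) * ?c"
    by (metis of_nat_mult)
  then show ?thesis
    using card_runs_pos[of T] node_count_pos[of ?S] by (simp add: field_simps)
qed

text \<open>The second name of the prefix determines the contracted child, so all these runs pass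
  through one contraction.\<close>

lemma runs_with_prefix_step:
  assumes "process_tree T" "i < length (children T)"
  shows "{\<rho> \<in> runs T. prefix (label T # label (T \<lhd> Suc i) # \<sigma>) \<rho>} =
    Cons (label T) ` {\<rho> \<in> runs (T \<lhd> Suc i). prefix (label (T \<lhd> Suc i) # \<sigma>) \<rho>}" (is "?A = ?B")
proof
  show "?B \<subseteq> ?A" using assms(2) by (subst runs_step) auto
  show "?A \<subseteq> ?B"
  proof
    fix \<rho> assume \<rho>: "\<rho> \<in> ?A"
    then have "\<rho> \<in> runs T" by simp
    then show "\<rho> \<in> ?B"
    proof (cases rule: runs_cases)
      case leaf
      then show ?thesis using assms(2) by simp
    next
      case (step j \<rho>')
      then have pre: "prefix (label (T \<lhd> Suc i) # \<sigma>) \<rho>'" using \<rho> by simp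
      then have "label (T \<lhd> Suc i) = label (T \<lhd> Suc j)"
        using step(2) runs_ConsD by (auto simp: prefix_def)
      then have "j = i"
        using inj_on_label_children[OF assms(1)] step(1) assms(2)
        by (auto simp: label_contraction dest: inj_onD)
      then show ?thesis using step pre by auto
    qed
  qed
qed

text \<open>Each name consumed replaces \<open>T\<close> by a contraction, so the tree and the run
  vary in the induction. The run \<open>\<rho>\<close> guarantees that the next name belongs to a
  child of the current root.\<close>

lemma prefix_frequency:
  assumes "process_tree T" "\<rho> \<in> runs T" "prefix \<sigma> \<rho>"
  shows "real (card {\<rho> \<in> runs T. prefix \<sigma> \<rho>}) / card (runs T) =
    (\<Prod>k<length \<sigma>. real (node_count (subtree_at T (\<sigma> ! k))) / (real (node_count T) - real k))"
  using assms
proof (induction \<sigma> arbitrary: T \<rho>)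
  case Nil
  then show ?case using card_runs_pos[of T] by simp
next
  case (Cons a \<sigma>)
  have a: "a = label T"
    using Cons.prems(2,3) runs_ConsD by (auto simp: prefix_def)
  have root: "node_count (subtree_at T' (label T')) = node_count T'" if "process_tree T'"
    for T' :: "'a ptree"
    using subtree_at_label[OF that self_in_subtrees] by simp
  show ?case
  proof (cases \<sigma>)
    case Nil
    \<comment> \<open>All runs start at the root: the frequency is 1, as is the single factor |T| /
      |T|.\<close>
    have "{\<rho> \<in> runs T. prefix [a] \<rho>} = runs T"
      using a by (auto elim: runs_cases)
    then show ?thesis
      using Nil a card_runs_pos[of T] node_count_pos[of T] root[OF Cons.prems(1)] by simp
  next
    case (Cons b \<sigma>')
    from \<open>\<rho> \<in> runs T\<close> obtain i \<rho>' where i: "i < length (children T)"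
      and \<rho>': "\<rho>' \<in> runs (T \<lhd> Suc i)" "\<rho> = label T # \<rho>'"
      using Cons.prems(3) Cons by (cases rule: runs_cases) auto
    define S where "S = T \<lhd> Suc i"
    have pre: "prefix \<sigma> \<rho>'" using Cons.prems(3) \<rho>' by simp
    have b: "b = label S"
      using pre Cons \<rho>'(1) runs_ConsD by (auto simp: prefix_def S_def)
    have S: "process_tree S"
      using process_tree_contraction[OF Cons.prems(1) i] by (simp add: S_def)
    have n: "node_count T = Suc (node_count S)"
      using node_count_contraction_Suc[OF i] by (simp add: S_def)
    have mset: "mset \<rho>' = mset (preorder S)"
      using mset_run \<rho>'(1) by (simp add: S_def)
    then have "distinct \<rho>'"
      using S by (metis mset_eq_imp_distinct_iff process_tree_def)
    then have "distinct \<sigma>"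
      using pre by (auto simp: prefix_def)
    have "set \<sigma> \<subseteq> set (preorder S)"
      using pre mset by (metis mset_eq_setD set_mono_prefix)
    \<comment> \<open>Distinctness keeps \<open>b\<close>, the root of \<open>S\<close>, out of
      \<open>\<sigma>'\<close>.\<close>
    have sub: "subtree_at S v = subtree_at T v" if "v \<in> set \<sigma>'" for v
      using subtree_at_contraction[OF Cons.prems(1) i, of v] that b Cons
        \<open>distinct \<sigma>\<close> \<open>set \<sigma> \<subseteq> set (preorder S)\<close> by (auto simp: S_def)
    let ?f = "\<lambda>T \<sigma> k. real (node_count (subtree_at T (\<sigma> ! k))) / (real (node_count T) - real k)"
    \<comment> \<open>The index shift offsets the loss of one node: |S| - (k + 1) = |T| - (k +
      2).\<close>
    have tail: "(\<Prod>k<length \<sigma>'. ?f S \<sigma> (Suc k)) = (\<Prod>k<length \<sigma>'. ?f T (a # \<sigma>) (Suc (Suc k)))"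
      using Cons sub n by (intro prod.cong) auto
    have "children T ! i \<in> subtrees T"
      using i by (cases T) (auto intro!: bexI[of _ "children T ! i"] self_in_subtrees)
    \<comment> \<open>The name \<open>b\<close> is the exception: its subtree in \<open>S\<close> is
      all of \<open>S\<close>, but in \<open>T\<close> it is the contracted child.\<close>
    then have child: "subtree_at T b = children T ! i"
      using subtree_at_label[OF Cons.prems(1)] b by (metis S_def label_contraction)
    have "real (card {\<rho> \<in> runs T. prefix (a # \<sigma>) \<rho>}) / card (runs T) =
        card {\<rho> \<in> runs S. prefix \<sigma> \<rho>} / card (runs T)"
      using runs_with_prefix_step[OF Cons.prems(1) i, of \<sigma>'] a b Cons
      by (simp add: S_def card_image)
    also have "\<dots> = (card (runs S) / card (runs T)) * (card {\<rho> \<in> runs S. prefix \<sigma> \<rho>} / card (runs S))"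
      using card_runs_pos[of S] by simp
    also have "\<dots> = node_count (children T ! i) / node_count S * (\<Prod>k<length \<sigma>. ?f S \<sigma> k)"
      using transition_probability[OF Cons.prems(1) i] Cons.IH[OF S _ pre] \<rho>'(1)
      by (simp add: S_def)
    \<comment> \<open>The factor of \<open>b\<close> in \<open>S\<close> is |S| / |S| = 1 and drops
      out.\<close>
    also have "(\<Prod>k<length \<sigma>. ?f S \<sigma> k) = (\<Prod>k<length \<sigma>'. ?f S \<sigma> (Suc k))"
      using Cons b root[OF S] node_count_pos[of S]
      by (simp add: prod.lessThan_Suc_shift del: prod.lessThan_Suc)
    \<comment> \<open>In \<open>T\<close> the root contributes 1 and \<open>b\<close> contributes
      the size of the child over |T| - 1 = |S|.\<close>
    also have "node_count (children T ! i) / node_count S * \<dots> = (\<Prod>k<length (a # \<sigma>). ?f T (a # \<sigma>) k)"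
      unfolding tail using Cons a child n root[OF Cons.prems(1)]
      by (simp add: prod.lessThan_Suc_shift algebra_simps del: prod.lessThan_Suc)
    finally show ?thesis .
  qed
qed

theorem corollary34:
  fixes T :: "'a ptree" and \<sigma> :: "'a list" and p :: nat
  assumes "process_tree T"
    and "run_prefix T p \<sigma>"
  shows "measure_pmf.prob (random_run T) {\<rho>. prefix \<sigma> \<rho>} =
    (\<Prod>k = 1..p. real (node_count (subtree_at T (\<sigma> ! (k - 1)))) / (real (node_count T) - real k + 1))"
proof -
  obtain \<rho> where \<rho>: "\<rho> \<in> runs T" "p \<le> length \<rho>" "\<sigma> = take p \<rho>"
    using assms(2) by (auto simp: run_prefix_def)
  then have p: "length \<sigma> = p" and pre: "prefix \<sigma> \<rho>"
    by (auto simp: take_is_prefix)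
  have "measure_pmf.prob (random_run T) {\<rho>. prefix \<sigma> \<rho>} =
      real (card {\<rho> \<in> runs T. prefix \<sigma> \<rho>}) / card (runs T)"
    unfolding random_run_def
    by (simp add: measure_pmf_of_set runs_nonempty finite_runs Int_def)
  also have "\<dots> = (\<Prod>k<p. real (node_count (subtree_at T (\<sigma> ! k))) / (real (node_count T) - real k))"
    using prefix_frequency[OF assms(1) \<rho>(1) pre] p by simp
  also have "\<dots> = (\<Prod>k = 1..p. real (node_count (subtree_at T (\<sigma> ! (k - 1)))) /
      (real (node_count T) - real k + 1))"
    \<comment> \<open>Passing from 0-based to 1-based positions turns |T| - k into |T| - k +
      1.\<close>
    by (rule prod.reindex_bij_witness[of _ "\<lambda>k. k - 1" Suc]) auto
  finally show ?thesis .
qed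

end
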